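(* Let $\mathbb{M}=\langle V,D,\cdot_{\mathbb{M}}\rangle$ be a $\Sigma$-PNmatrix and let $\mathsf{Ax}\subseteq L_\Sigma(P)$. Suppose there exists $\Sigma^d\subseteq\Sigma$ such that $\mathbb{M}$ is a rexpansion of some $\Sigma^d$-deterministic $\Sigma$-PNmatrix, and all formulas in $\mathsf{Ax}$ are $\Sigma^d$-simple. Let $\Theta_{\mathsf{Ax}}$ be the look-ahead set induced by $\mathsf{Ax}$, let $\mathrm{Val}_{\mathbb{M}}^{\mathsf{Ax}}=\{v\in\mathrm{Val}_{\mathbb{M}}: v(\mathsf{Ax}^{\mathsf{inst}})\subseteq D\}$, and for $v\in\mathrm{Val}_{\mathbb{M}}$ and $A\in L_\Sigma(P)$ let $f^A_v:\Theta_{\mathsf{Ax}}\to V$ be given by $f^A_v(w)=v(wA)$. Define $\mathbb{M}^\sharp_{\mathsf{Ax}}=\langle V^\sharp_{\mathsf{Ax}},D^\sharp_{\mathsf{Ax}},\cdot_{\mathbb{M}^\sharp_{\mathsf{Ax}}}\rangle$ by \begin{itemize} \item $V^\sharp_{\mathsf{Ax}}=\bigcup_{v\in\mathrm{Val}_{\mathbb{M}}^{\mathsf{Ax}}}\{f^A_v:A\in L_\Sigma(P)\}$, \item $D^\sharp_{\mathsf{Ax}}=\{f\in V^\sharp_{\mathsf{Ax}}:f(\varepsilon)\in D\}$, \item for each $k\in\mathbb{N}$ and each $c\in\Sigma^{(k)}$, $$c_{\mathbb{M}^\sharp_{\mathsf{Ax}}}(f_1,\dots,f_k)=\bigcup_{v\in\mathrm{Val}_{\mathbb{M}}^{\mathsf{Ax}}}\{f^{c(A_1,\dots,A_k)}_v:A_i\in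 L_\Sigma(P)\text{ with }f^{A_i}_v=f_i\text{ for }1\leq i\leq k\}.$$ \end{itemize} Then $\mathbb{M}^\sharp_{\mathsf{Ax}}$ is a rexpansion of $\mathbb{M}$, and the consequence relation $\vdash_{\mathbb{M}}^{\mathsf{Ax}}$ is characterized by $\mathbb{M}^\sharp_{\mathsf{Ax}}$, that is, $\vdash_{\mathbb{M}}^{\mathsf{Ax}}\;=\;\vdash_{\mathbb{M}^\sharp_{\mathsf{Ax}}}$.
   Context: A signature $\Sigma$ is a family $\{\Sigma^{(k)}\}_{k\in\mathbb{N}}$ of sets, $\Sigma^{(k)}$ being the set of $k$-place connectives; $\Sigma^d\subseteq\Sigma$ means componentwise inclusion. $L_\Sigma(P)$ is the set of formulas (the absolutely free $\Sigma$-algebra) over a fixed denumerable set $P$ of sentential variables; for $Q\subseteq P$, $L_\Sigma(Q)$ is the set of formulas with variables in $Q$. A substitution is a function $\sigma:P\to L_\Sigma(P)$; $A^\sigma$ is the result of applying (the endomorphism extending) $\sigma$ to $A$. For $\Gamma\subseteq L_\Sigma(P)$, $\Gamma^{\mathsf{inst}}=\{A^\sigma: A\in\Gamma,\ \sigma:P\to L_\Sigma(P)\}$. A $\Sigma$-PNmatrix (partial non-deterministic matrix) is $\mathbb{M}=\langle V,D,\cdot_{\mathbb{M}}\rangle$ with $V$ a set (truth-values), $D\subseteq V$ (designated values), and, for each $k$ and each $c\in\Sigma^{(k)}$, a function $c_{\mathbb{M}}:V^k\to\wp(V)$ (the empty set is an allowed output). It is $\Sigma'$-deterministic, for $\Sigma'\subseteq\Sigma$,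 if $c_{\mathbb{M}}(x_1,\dots,x_k)$ has at most one element for every $k$, every $c\in\Sigma'^{(k)}$ and all $x_1,\dots,x_k\in V$. An $\mathbb{M}$-valuation is a function $v:L_\Sigma(P)\to V$ with $v(c(A_1,\dots,A_k))\in c_{\mathbb{M}}(v(A_1),\dots,v(A_k))$ for all $k$, all $c\in\Sigma^{(k)}$ and all formulas $A_1,\dots,A_k$; $\mathrm{Val}_{\mathbb{M}}$ is the set of all $\mathbb{M}$-valuations. The consequence relation characterized by $\mathbb{M}$ is: $\Gamma\vdash_{\mathbb{M}}A$ iff for every $v\in\mathrm{Val}_{\mathbb{M}}$, $v(\Gamma)\subseteq D$ implies $v(A)\in D$. The strengthening of $\vdash_{\mathbb{M}}$ with (schema) axioms $\mathsf{Ax}$ is: $\Gamma\vdash_{\mathbb{M}}^{\mathsf{Ax}}A$ iff $\Gamma\cup\mathsf{Ax}^{\mathsf{inst}}\vdash_{\mathbb{M}}A$. Rexpansions: a refinement of $\mathbb{M}=\langle V,D,\cdot_{\mathbb{M}}\rangle$ is any $\Sigma$-PNmatrix $\mathbb{M}'=\langle V',D',\cdot_{\mathbb{M}'}\rangle$ with $V'\subseteq V$, $D'=D\cap V'$ and $c_{\mathbb{M}'}(x_1,\dots,x_k)\subseteq c_{\mathbb{M}}(x_1,\dots,x_k)$ for all $c\in\Sigma^{(k)}$ and $x_1,\dots,x_k\in V'$. An expansion function is $\mathcal{E}:V\to\wp(U)$ (for some set $U$) with $\mathcal{E}(x)\neq\emptyset$ for all $x\in V$ and $\mathcal{E}(x)\cap\mathcal{E}(x')=\emptyset$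 for $x\neq x'$; put $\mathcal{E}(X)=\bigcup_{x\in X}\mathcal{E}(x)$ for $X\subseteq V$, and let $\widetilde{\mathcal{E}}:\mathcal{E}(V)\to V$ send $y$ to the unique $x$ with $y\in\mathcal{E}(x)$. The $\mathcal{E}$-expansion of $\mathbb{M}$ is $\mathcal{E}(\mathbb{M})=\langle\mathcal{E}(V),\mathcal{E}(D),\cdot_{\mathcal{E}(\mathbb{M})}\rangle$ with $c_{\mathcal{E}(\mathbb{M})}(y_1,\dots,y_k)=\mathcal{E}(c_{\mathbb{M}}(\widetilde{\mathcal{E}}(y_1),\dots,\widetilde{\mathcal{E}}(y_k)))$. A rexpansion of $\mathbb{M}$ is a refinement of some $\mathcal{E}$-expansion of $\mathbb{M}$. Simple formulas and look-ahead: given $\Sigma^d\subseteq\Sigma$, let $\mathcal{U}$ be the set of all 1-place connectives of $\Sigma$ not in $\Sigma^d$, and $\mathcal{U}^*$ the set of finite strings over $\mathcal{U}$, with empty string $\varepsilon$; $\mathsf{prfx}(w)$ is the set of all prefixes of $w$, including $\varepsilon$ (and $w$ itself). For $w\in\mathcal{U}^*$ and a formula $A$, the formula $wA$ is defined by $\varepsilon A=A$ and $(\bullet w)A=\bullet(wA)$ for $\bullet\in\mathcal{U}$. For distinct variables $p_1,p_2,\dots$ and a $k$-place connective $c\in\Sigma$, a $\Sigma^d$-simple formula based on $c$ is a formula $B\in L_\Sigma(\{p_1,\dots,p_k\})$ such that $B=A^\sigma$ for some structure formula $A\in L_{\Sigma^d}(\{q_1,\dots,q_n,r_1,\dots,r_m\})$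 (with $q_1,\dots,q_n,r_1,\dots,r_m$ distinct variables, not all of which need to occur in $A$) and some substitution $\sigma$ such that: for each $1\le i\le n$, $\sigma(q_i)=w_ip_j$ for some $w_i\in\mathcal{U}^*$ and some $1\le j\le k$; and for each $1\le l\le m$, $\sigma(r_l)=u_l\,c(p_1,\dots,p_k)$ for some $u_l\in\mathcal{U}^*$. The look-ahead set induced by $B$ is $\Theta_B=\bigcup_{i=1}^n\mathsf{prfx}(w_i)\cup\bigcup_{l=1}^m\mathsf{prfx}(u_l)$, computed from a fixed choice of such $A,\sigma$ for $B$. A formula is $\Sigma^d$-simple if it is $\Sigma^d$-simple based on some connective of $\Sigma$. For a set $\Gamma$ of $\Sigma^d$-simple formulas, $\Theta_\Gamma=\{\varepsilon\}\cup\bigcup_{B\in\Gamma}\Theta_B$. *)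

theory Defs
  imports Main "HOL-Library.FuncSet" "HOL-Library.Disjoint_Sets" "HOL-Library.Sublist"
begin

text \<open>
  A signature assigns to every arity \<open>k\<close> the set of its \<open>k\<close>-place connectives. The same symbol may
  occur at several arities: the arity of an occurrence is the length of its argument list.
  The denumerable set of sentential variables is the type \<^typ>\<open>nat\<close>.
\<close>

type_synonym 'c signature = "nat \<Rightarrow> 'c set"

datatype 'c fm = Var nat | App 'c "'c fm list"

inductive_set formulas :: "'c signature \<Rightarrow> nat set \<Rightarrow> 'c fm set"
  for Sig :: "'c signature" and Q :: "nat set" where
  Var: "p \<in> Q \<Longrightarrow> Var p \<in> formulas Sig Q"
| App: "c \<in> Sig (length As) \<Longrightarrow> (\<And>A. A \<in> set As \<Longrightarrow> A \<in> formulas Sig Q)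
         \<Longrightarrow> App c As \<in> formulas Sig Q"

abbreviation forms :: "'c signature \<Rightarrow> 'c fm set" where
  "forms Sig \<equiv> formulas Sig UNIV"

definition substitutions :: "'c signature \<Rightarrow> (nat \<Rightarrow> 'c fm) set" where
  "substitutions Sig = {\<sigma>. \<forall>p. \<sigma> p \<in> forms Sig}"

primrec subst :: "(nat \<Rightarrow> 'c fm) \<Rightarrow> 'c fm \<Rightarrow> 'c fm" where
  "subst \<sigma> (Var p) = \<sigma> p"
| "subst \<sigma> (App c As) = App c (map (subst \<sigma>) As)"

definition inst :: "'c signature \<Rightarrow> 'c fm set \<Rightarrow> 'c fm set" where
  "inst Sig \<Gamma> = {subst \<sigma> A | \<sigma> A. \<sigma> \<in> substitutions Sig \<and> A \<in> \<Gamma>}"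


text \<open>
  In a PNmatrix, \<open>interp M c xs\<close> is only meaningful when \<open>c\<close> is a connective of arity \<open>length xs\<close>
  and all entries of \<open>xs\<close> are truth-values of \<open>M\<close>; every notion below ignores the other arguments.
\<close>

record ('c, 'v) pnmatrix =
  vals :: "'v set"
  desig :: "'v set"
  interp :: "'c \<Rightarrow> 'v list \<Rightarrow> 'v set"

definition is_pnmatrix :: "'c signature \<Rightarrow> ('c, 'v) pnmatrix \<Rightarrow> bool" where
  "is_pnmatrix Sig M \<longleftrightarrow>
     desig M \<subseteq> vals M \<and>
     (\<forall>c xs. c \<in> Sig (length xs) \<and> set xs \<subseteq> vals M \<longrightarrow> interp M c xs \<subseteq> vals M)"

definition deterministic :: "'c signature \<Rightarrow> ('c, 'v) pnmatrix \<Rightarrow> bool" where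
  "deterministic Sig' M \<longleftrightarrow>
     (\<forall>c xs. c \<in> Sig' (length xs) \<and> set xs \<subseteq> vals M \<longrightarrow> (\<exists>\<^sub>\<le>\<^sub>1 y. y \<in> interp M c xs))"

definition Val :: "'c signature \<Rightarrow> ('c, 'v) pnmatrix \<Rightarrow> ('c fm \<Rightarrow> 'v) set" where
  "Val Sig M = {v \<in> forms Sig \<rightarrow>\<^sub>E vals M.
     \<forall>c As. c \<in> Sig (length As) \<and> set As \<subseteq> forms Sig \<longrightarrow>
       v (App c As) \<in> interp M c (map v As)}"

definition conseq :: "'c signature \<Rightarrow> ('c, 'v) pnmatrix \<Rightarrow> 'c fm set \<Rightarrow> 'c fm \<Rightarrow> bool" where
  "conseq Sig M \<Gamma> A \<longleftrightarrow>
     \<Gamma> \<subseteq> forms Sig \<and> A \<in> forms Sig \<and>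
     (\<forall>v \<in> Val Sig M. v ` \<Gamma> \<subseteq> desig M \<longrightarrow> v A \<in> desig M)"

definition conseq_ax ::
  "'c signature \<Rightarrow> ('c, 'v) pnmatrix \<Rightarrow> 'c fm set \<Rightarrow> 'c fm set \<Rightarrow> 'c fm \<Rightarrow> bool" where
  "conseq_ax Sig M Ax \<Gamma> A \<longleftrightarrow> conseq Sig M (\<Gamma> \<union> inst Sig Ax) A"


definition refinement :: "'c signature \<Rightarrow> ('c, 'v) pnmatrix \<Rightarrow> ('c, 'v) pnmatrix \<Rightarrow> bool" where
  "refinement Sig M M' \<longleftrightarrow>
     is_pnmatrix Sig M' \<and>
     vals M' \<subseteq> vals M \<and>
     desig M' = desig M \<inter> vals M' \<and>
     (\<forall>c xs. c \<in> Sig (length xs) \<and> set xs \<subseteq> vals M' \<longrightarrow> interp M' c xs \<subseteq> interp M c xs)"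

definition expansion_fun :: "'v set \<Rightarrow> ('v \<Rightarrow> 'u set) \<Rightarrow> bool" where
  "expansion_fun V E \<longleftrightarrow> (\<forall>x\<in>V. E x \<noteq> {}) \<and> disjoint_family_on E V"

definition contract :: "'v set \<Rightarrow> ('v \<Rightarrow> 'u set) \<Rightarrow> 'u \<Rightarrow> 'v" where
  "contract V E y = (THE x. x \<in> V \<and> y \<in> E x)"

definition expansion :: "('v \<Rightarrow> 'u set) \<Rightarrow> ('c, 'v) pnmatrix \<Rightarrow> ('c, 'u) pnmatrix" where
  "expansion E M = \<lparr>
     vals = \<Union> (E ` vals M),
     desig = \<Union> (E ` desig M),
     interp = \<lambda>c ys. \<Union> (E ` interp M c (map (contract (vals M) E) ys)) \<rparr>"

text \<open>\<open>rexpansion Sig M M'\<close>: \<open>M'\<close> is a rexpansion of \<open>M\<close>.\<close>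

definition rexpansion :: "'c signature \<Rightarrow> ('c, 'v) pnmatrix \<Rightarrow> ('c, 'u) pnmatrix \<Rightarrow> bool" where
  "rexpansion Sig M M' \<longleftrightarrow>
     (\<exists>E. expansion_fun (vals M) E \<and> refinement Sig (expansion E M) M')"


definition unaries :: "'c signature \<Rightarrow> 'c signature \<Rightarrow> 'c set" where
  "unaries Sig Sigd = Sig 1 - Sigd 1"

primrec app_str :: "'c list \<Rightarrow> 'c fm \<Rightarrow> 'c fm" where
  "app_str [] A = A"
| "app_str (u # w) A = App u [app_str w A]"

text \<open>
  A decomposition records the data witnessing that a formula \<open>B\<close> is simple: the connective \<open>c\<close>, the
  variables \<open>p\<^sub>1, \<dots>, p\<^sub>k\<close> (so \<open>k\<close> is the length of the list), the structure formula,
  the substitution, and the variables \<open>q\<^sub>i\<close> and \<open>r\<^sub>l\<close>, each paired with its string \<open>w\<^sub>i\<close> or \<open>u\<^sub>l\<close>.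
  The look-ahead set depends on this data and not just on \<open>B\<close>.
\<close>

record 'c decomp =
  base :: 'c
  pvars :: "nat list"
  struct_fm :: "'c fm"
  subst_of :: "nat \<Rightarrow> 'c fm"
  qvars :: "(nat \<times> 'c list) list"
  rvars :: "(nat \<times> 'c list) list"

definition decomposes :: "'c signature \<Rightarrow> 'c signature \<Rightarrow> 'c fm \<Rightarrow> 'c decomp \<Rightarrow> bool" where
  "decomposes Sig Sigd B d \<longleftrightarrow>
     base d \<in> Sig (length (pvars d)) \<and>
     distinct (pvars d) \<and>
     B \<in> formulas Sig (set (pvars d)) \<and>
     distinct (map fst (qvars d @ rvars d)) \<and>
     struct_fm d \<in> formulas Sigd (fst ` set (qvars d @ rvars d)) \<and>
     subst_of d \<in> substitutions Sig \<and>
     B = subst (subst_of d) (struct_fm d) \<and>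
     (\<forall>(q, w) \<in> set (qvars d). w \<in> lists (unaries Sig Sigd) \<and>
        (\<exists>p \<in> set (pvars d). subst_of d q = app_str w (Var p))) \<and>
     (\<forall>(r, u) \<in> set (rvars d). u \<in> lists (unaries Sig Sigd) \<and>
        subst_of d r = app_str u (App (base d) (map Var (pvars d))))"

definition simple :: "'c signature \<Rightarrow> 'c signature \<Rightarrow> 'c fm \<Rightarrow> bool" where
  "simple Sig Sigd B \<longleftrightarrow> (\<exists>d. decomposes Sig Sigd B d)"

definition lookahead :: "'c decomp \<Rightarrow> 'c list set" where
  "lookahead d = (\<Union>(q, w) \<in> set (qvars d). {x. prefix x w}) \<union>
                 (\<Union>(r, u) \<in> set (rvars d). {x. prefix x u})"

text \<open>Here \<open>dec\<close> is the fixed choice of a decomposition for each formula of \<open>\<Gamma>\<close>.\<close>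

definition lookahead_set :: "('c fm \<Rightarrow> 'c decomp) \<Rightarrow> 'c fm set \<Rightarrow> 'c list set" where
  "lookahead_set dec \<Gamma> = {[]} \<union> (\<Union>B \<in> \<Gamma>. lookahead (dec B))"


definition ValAx :: "'c signature \<Rightarrow> ('c, 'v) pnmatrix \<Rightarrow> 'c fm set \<Rightarrow> ('c fm \<Rightarrow> 'v) set" where
  "ValAx Sig M Ax = {v \<in> Val Sig M. v ` inst Sig Ax \<subseteq> desig M}"

text \<open>
  Functions on the look-ahead set \<open>\<Theta>\<close> are made extensional, so that equality of such
  functions is equality on \<open>\<Theta>\<close>.
\<close>

definition look :: "'c list set \<Rightarrow> ('c fm \<Rightarrow> 'v) \<Rightarrow> 'c fm \<Rightarrow> ('c list \<Rightarrow> 'v)" where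
  "look \<Theta> v A = restrict (\<lambda>w. v (app_str w A)) \<Theta>"

definition sharp_vals ::
  "'c signature \<Rightarrow> ('c, 'v) pnmatrix \<Rightarrow> 'c fm set \<Rightarrow> 'c list set \<Rightarrow> ('c list \<Rightarrow> 'v) set" where
  "sharp_vals Sig M Ax \<Theta> = (\<Union>v \<in> ValAx Sig M Ax. {look \<Theta> v A | A. A \<in> forms Sig})"

definition sharp ::
  "'c signature \<Rightarrow> ('c, 'v) pnmatrix \<Rightarrow> 'c fm set \<Rightarrow> 'c list set
     \<Rightarrow> ('c, 'c list \<Rightarrow> 'v) pnmatrix" where
  "sharp Sig M Ax \<Theta> = \<lparr>
     vals = sharp_vals Sig M Ax \<Theta>,
     desig = {f \<in> sharp_vals Sig M Ax \<Theta>. f [] \<in> desig M},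
     interp = \<lambda>c fs. \<Union>v \<in> ValAx Sig M Ax.
       {look \<Theta> v (App c As) | As. set As \<subseteq> forms Sig \<and> map (look \<Theta> v) As = fs} \<rparr>"

end

theory Submission
  imports Defs
begin

text \<open>
  Evaluating look-ahead functions at the empty string exhibits the new matrix as a rexpansion. Every
  \<open>v\<close> satisfying the axioms lifts to the valuation sending \<open>A\<close> to \<open>look \<Theta> v A\<close>. Conversely,
  let \<open>h\<close> be a valuation of the new matrix and \<open>v A = h A []\<close>. Unfolding one unary connective at a
  time gives \<open>h A w = v (w A)\<close> on \<open>\<Theta>\<close>. For an instance of an axiom based on \<open>c\<close>, the
  single step \<open>h (c(A\<^sub>1, \<dots>, A\<^sub>k))\<close> provides a valuation \<open>v'\<close> satisfying the axioms
  and formulas \<open>A\<^sub>i'\<close> with the same look-ahead. Hence \<open>v\<close> and \<open>v'\<close> agree at the leaves of the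
  structure formula. Contracted to the deterministic matrix they agree on the whole instance;
  contraction preserves and reflects designation.
\<close>

section \<open>Formulas and strings of unary connectives\<close>

lemma subst_in_forms:
  assumes "A \<in> formulas Sig Q" and "\<sigma> \<in> substitutions Sig"
  shows "subst \<sigma> A \<in> forms Sig"
  using assms(1)
proof induction
  case (Var p)
  then show ?case using assms(2) by (simp add: substitutions_def)
next
  case (App c As)
  then show ?case by (auto intro!: formulas.App)
qed

lemma inst_subset_forms: "\<Gamma> \<subseteq> forms Sig \<Longrightarrow> inst Sig \<Gamma> \<subseteq> forms Sig"
  by (auto simp: inst_def intro: subst_in_forms)

lemma formulas_mono:
  assumes "A \<in> formulas Sig Q" and "\<forall>k. Sig k \<subseteq> Sig' k"
  shows "A \<in> formulas Sig' Q"
  using assms(1)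
proof induction
  case (App c As)
  then show ?case using assms(2) by (blast intro: formulas.App)
qed (rule formulas.Var)

lemma subst_subst: "subst \<tau> (subst \<sigma> A) = subst (\<lambda>p. subst \<tau> (\<sigma> p)) A"
  by (induction A) auto

lemma app_str_append: "app_str (u @ w) A = app_str u (app_str w A)"
  by (induction u) auto

lemma subst_app_str: "subst \<tau> (app_str w A) = app_str w (subst \<tau> A)"
  by (induction w) auto

lemma unary_in_forms: "u \<in> Sig 1 \<Longrightarrow> A \<in> forms Sig \<Longrightarrow> App u [A] \<in> forms Sig"
  by (rule formulas.App) auto

section \<open>Contracting valuations along a rexpansion\<close>

lemma contract_eq:
  assumes "expansion_fun V E" "x \<in> V" "y \<in> E x"
  shows "contract V E y = x"
proof -
  have "x' = x" if "x' \<in> V" "y \<in> E x'" for x'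
    using assms that unfolding expansion_fun_def disjoint_family_on_def by blast
  then show ?thesis
    using assms(2,3) unfolding contract_def by (intro the_equality) blast+
qed

lemma contract_mem:
  assumes "expansion_fun V E" "y \<in> \<Union> (E ` V)"
  shows "contract V E y \<in> V" "y \<in> E (contract V E y)"
proof -
  obtain x where "x \<in> V" "y \<in> E x" using assms(2) by blast
  then show "contract V E y \<in> V" "y \<in> E (contract V E y)"
    using contract_eq[OF assms(1)] by simp_all
qed

lemma Val_in_forms: "v \<in> Val Sig M \<Longrightarrow> A \<in> forms Sig \<Longrightarrow> v A \<in> vals M"
  by (auto simp: Val_def)

text \<open>Outputs of \<open>M'\<close> lie in blocks \<open>E x\<close> with \<open>x\<close> an
  output of \<open>M\<close> at the contracted arguments, and contraction sends each block back to
  its \<open>x\<close>. The restriction to \<open>forms Sig\<close> is there because valuations are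
  extensional.\<close>

lemma contract_Val:
  assumes M: "is_pnmatrix Sig M" and E: "expansion_fun (vals M) E"
    and ref: "refinement Sig (expansion E M) M'" and v: "v \<in> Val Sig M'"
  shows "(\<lambda>A\<in>forms Sig. contract (vals M) E (v A)) \<in> Val Sig M"
proof -
  let ?k = "contract (vals M) E" and ?v = "\<lambda>A\<in>forms Sig. contract (vals M) E (v A)"
  have mem: "v A \<in> \<Union> (E ` vals M)" if "A \<in> forms Sig" for A
    using ref Val_in_forms[OF v that] by (auto simp: refinement_def expansion_def)
  have step: "?k (v (App c As)) \<in> interp M c (map (\<lambda>A. ?k (v A)) As)"
    if c: "c \<in> Sig (length As)" and As: "set As \<subseteq> forms Sig" for c As
  proof -
    have xs: "set (map (\<lambda>A. ?k (v A)) As) \<subseteq> vals M"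
      using As contract_mem(1)[OF E mem] by auto
    have "v (App c As) \<in> interp M' c (map v As)"
      using v c As by (auto simp: Val_def)
    moreover have "set (map v As) \<subseteq> vals M'"
      using Val_in_forms[OF v] As by auto
    ultimately have "v (App c As) \<in> interp (expansion E M) c (map v As)"
      using ref c unfolding refinement_def by (metis length_map subsetD)
    then obtain x where x: "x \<in> interp M c (map (\<lambda>A. ?k (v A)) As)" "v (App c As) \<in> E x"
      by (auto simp: expansion_def comp_def)
    \<comment> \<open>\<open>E\<close> is only known to be disjoint on \<open>vals M\<close>, so
      \<open>x\<close> must be located there before contraction can recover it.\<close>
    have "x \<in> vals M"
      using M c xs x(1) unfolding is_pnmatrix_def by (metis length_map subsetD)
    then show ?thesis using contract_eq[OF E _ x(2)] x(1) by simp
  qed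
  have "?v (App c As) \<in> interp M c (map ?v As)"
    if "c \<in> Sig (length As)" "set As \<subseteq> forms Sig" for c As
  proof -
    have "map ?v As = map (\<lambda>A. ?k (v A)) As" using that(2) by auto
    moreover have "?v (App c As) = ?k (v (App c As))"
      using that by (auto intro: formulas.App)
    ultimately show ?thesis using step[OF that] by (simp only:)
  qed
  moreover have "?v \<in> forms Sig \<rightarrow>\<^sub>E vals M"
    using contract_mem(1)[OF E mem] by auto
  ultimately show ?thesis unfolding Val_def by blast
qed

text \<open>Designated values of \<open>M'\<close> are those lying in a block over a designated
  value. Since the blocks are disjoint, the block of \<open>y\<close> determines its contraction,
  which gives both directions.\<close>

lemma contract_desig:
  assumes M: "is_pnmatrix Sig M" and E: "expansion_fun (vals M) E"
    and ref: "refinement Sig (expansion E M) M'" and y: "y \<in> vals M'"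
  shows "contract (vals M) E y \<in> desig M \<longleftrightarrow> y \<in> desig M'"
proof -
  have D: "desig M' = \<Union> (E ` desig M) \<inter> vals M'" and "y \<in> \<Union> (E ` vals M)"
    using ref y by (auto simp: refinement_def expansion_def)
  then have "y \<in> E (contract (vals M) E y)" using contract_mem(2)[OF E] by simp
  moreover have "desig M \<subseteq> vals M" using M by (simp add: is_pnmatrix_def)
  ultimately show ?thesis using D y contract_eq[OF E] by blast
qed

text \<open>At each connective of \<open>Sigd\<close> the two values lie in the same output set,
  which has at most one element. Both valuation and substitution may differ between the two sides,
  so that instances evaluated by unrelated valuations can be compared.\<close>

lemma deterministic_agree:
  assumes det: "deterministic Sigd M" and sub: "\<forall>k. Sigd k \<subseteq> Sig k"
    and v: "v \<in> Val Sig M" and v': "v' \<in> Val Sig M"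
    and s: "s \<in> substitutions Sig" and s': "s' \<in> substitutions Sig"
    and leaves: "\<And>q. q \<in> Q \<Longrightarrow> v (s q) = v' (s' q)"
    and A: "A \<in> formulas Sigd Q"
  shows "v (subst s A) = v' (subst s' A)"
  using A
proof induction
  case (Var p)
  then show ?case by (simp add: leaves)
next
  case (App c As)
  let ?Bs = "map (subst s) As" and ?Bs' = "map (subst s') As"
  have c: "c \<in> Sig (length As)" using App.hyps sub by auto
  have "A \<in> formulas Sig Q" if "A \<in> set As" for A
    using that App.hyps(2) sub formulas_mono by blast
  then have Bs: "set ?Bs \<subseteq> forms Sig" and Bs': "set ?Bs' \<subseteq> forms Sig"
    using s s' subst_in_forms by fastforce+
  have eq: "map v' ?Bs' = map v ?Bs" using App.IH by simp
  have "v (App c ?Bs) \<in> interp M c (map v ?Bs)"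
    using v c Bs unfolding Val_def by (simp only: mem_Collect_eq length_map)
  moreover have "v' (App c ?Bs') \<in> interp M c (map v ?Bs)"
    using v' c Bs' unfolding Val_def eq[symmetric] by (simp only: mem_Collect_eq length_map)
  moreover have "set (map v ?Bs) \<subseteq> vals M"
    using Val_in_forms[OF v] Bs by auto
  then have "\<exists>\<^sub>\<le>\<^sub>1 y. y \<in> interp M c (map v ?Bs)"
    using det App.hyps(1) unfolding deterministic_def by (metis length_map)
  ultimately show ?case by (auto dest: Uniq_D)
qed

section \<open>The look-ahead matrix\<close>

lemma Nil_in_lookahead_set: "[] \<in> lookahead_set dec \<Gamma>"
  by (simp add: lookahead_set_def)

text \<open>Closure under prefixes allows a look-ahead to be computed one letter at a time without
  leaving the set.\<close>

lemma lookahead_set_prefix: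
  assumes "w \<in> lookahead_set dec \<Gamma>" "prefix u w"
  shows "u \<in> lookahead_set dec \<Gamma>"
proof -
  have "u \<in> lookahead d" if "w \<in> lookahead d" for d
    using that assms(2) unfolding lookahead_def by (auto dest: prefix_order.trans)
  then show ?thesis using assms unfolding lookahead_set_def by auto
qed

lemma look_apply: "w \<in> \<Theta> \<Longrightarrow> look \<Theta> v A w = v (app_str w A)"
  by (simp add: look_def)

lemma look_eqD: "look \<Theta> v A = f \<Longrightarrow> w \<in> \<Theta> \<Longrightarrow> v (app_str w A) = f w"
  using look_apply[of w \<Theta> v A] by simp

lemma ValAxD: "v \<in> ValAx Sig M Ax \<Longrightarrow> v \<in> Val Sig M"
  by (simp add: ValAx_def)

section \<open>Evaluation as a rexpansion, and lifting of valuations\<close>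

text \<open>The blocks are the fibres of evaluation at \<open>a\<close>: disjoint as such, and
  nonempty because of constant functions.\<close>

lemma expansion_fun_eval: "expansion_fun (V :: 'a set) (\<lambda>x. {f. f a = x})"
proof -
  have "{f. f a = x} \<noteq> {}" for x :: 'a
    using exI[of "\<lambda>f. f a = x" "\<lambda>_. x"] by simp
  then show ?thesis by (auto simp only: expansion_fun_def disjoint_family_on_def)
qed

lemma contract_eval: "f a \<in> V \<Longrightarrow> contract V (\<lambda>x. {f. f a = x}) f = f a"
  by (rule contract_eq[OF expansion_fun_eval[of V a]]) simp_all

lemma sharp_vals_Nil:
  assumes "[] \<in> \<Theta>" "f \<in> sharp_vals Sig M Ax \<Theta>"
  shows "f [] \<in> vals M"
  using assms by (auto simp: sharp_vals_def look_def dest!: ValAxD intro: Val_in_forms)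

lemma sharp_interpD:
  assumes "f \<in> interp (sharp Sig M Ax \<Theta>) c fs"
  obtains v As where "v \<in> ValAx Sig M Ax" "set As \<subseteq> forms Sig"
    "map (look \<Theta> v) As = fs" "f = look \<Theta> v (App c As)"
  using assms by (auto simp: sharp_def)

lemma is_pnmatrix_sharp: "is_pnmatrix Sig (sharp Sig M Ax \<Theta>)" (is "is_pnmatrix Sig ?S")
proof -
  have "f \<in> sharp_vals Sig M Ax \<Theta>"
    if "c \<in> Sig (length fs)" "f \<in> interp ?S c fs" for c fs f
    using that(2)
  proof (rule sharp_interpD)
    fix v As
    assume v: "v \<in> ValAx Sig M Ax" and As: "set As \<subseteq> forms Sig"
      and fs: "map (look \<Theta> v) As = fs" and f: "f = look \<Theta> v (App c As)"
    have "App c As \<in> forms Sig" using that(1) As fs by (auto intro: formulas.App)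
    then show ?thesis using v f by (auto simp: sharp_vals_def)
  qed
  moreover have "vals ?S = sharp_vals Sig M Ax \<Theta>" "desig ?S \<subseteq> sharp_vals Sig M Ax \<Theta>"
    by (auto simp: sharp_def)
  ultimately show ?thesis unfolding is_pnmatrix_def by blast
qed

text \<open>Contraction is evaluation at \<open>[]\<close>, so arguments
  \<open>look \<Theta> v A\<close> contract to \<open>v A\<close>, and the claim reduces to
  \<open>v\<close> being a valuation of \<open>M\<close>.\<close>

lemma sharp_refinement:
  assumes M: "is_pnmatrix Sig M" and Nil: "[] \<in> \<Theta>"
  shows "refinement Sig (expansion (\<lambda>x. {f. f [] = x}) M) (sharp Sig M Ax \<Theta>)"
proof -
  let ?E = "\<lambda>x. {f :: 'a list \<Rightarrow> 'b. f [] = x}" and ?S = "sharp Sig M Ax \<Theta>"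
  have "f \<in> interp (expansion ?E M) c fs"
    if "c \<in> Sig (length fs)" and f: "f \<in> interp ?S c fs" for c fs f
    using f
  proof (rule sharp_interpD)
    fix v As
    assume v: "v \<in> ValAx Sig M Ax" and As: "set As \<subseteq> forms Sig"
      and fs: "map (look \<Theta> v) As = fs" and f: "f = look \<Theta> v (App c As)"
    have "map (contract (vals M) ?E) fs = map v As"
      using As Val_in_forms[OF ValAxD[OF v]] Nil
      by (auto simp: fs[symmetric] contract_eval look_apply)
    moreover have "length As = length fs" using fs by auto
    then have "v (App c As) \<in> interp M c (map v As)"
      using ValAxD[OF v] \<open>c \<in> Sig (length fs)\<close> As by (simp add: Val_def)
    ultimately show ?thesis using Nil by (simp add: expansion_def f look_apply)
  qed
  moreover have "vals ?S \<subseteq> vals (expansion ?E M)"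
    using sharp_vals_Nil[OF Nil] by (auto simp: sharp_def expansion_def)
  moreover have "desig ?S = desig (expansion ?E M) \<inter> vals ?S"
    by (auto simp: sharp_def expansion_def)
  ultimately show ?thesis
    using is_pnmatrix_sharp unfolding refinement_def by blast
qed

lemma look_Val:
  assumes "v \<in> ValAx Sig M Ax"
  shows "(\<lambda>A\<in>forms Sig. look \<Theta> v A) \<in> Val Sig (sharp Sig M Ax \<Theta>)"
proof -
  let ?h = "\<lambda>A\<in>forms Sig. look \<Theta> v A" and ?S = "sharp Sig M Ax \<Theta>"
  have "?h (App c As) \<in> interp ?S c (map ?h As)"
    if c: "c \<in> Sig (length As)" and As: "set As \<subseteq> forms Sig" for c As
  proof -
    have "map ?h As = map (look \<Theta> v) As" using As by auto
    moreover have "?h (App c As) = look \<Theta> v (App c As)"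
      using c As by (auto intro: formulas.App)
    moreover have "look \<Theta> v (App c As) \<in> interp ?S c (map (look \<Theta> v) As)"
      using assms As by (auto simp: sharp_def)
    ultimately show ?thesis by (simp only:)
  qed
  moreover have "?h \<in> forms Sig \<rightarrow>\<^sub>E vals ?S"
    using assms by (auto simp: sharp_def sharp_vals_def)
  ultimately show ?thesis unfolding Val_def by blast
qed

section \<open>From valuations of the look-ahead matrix to valuations satisfying the axioms\<close>

text \<open>The induction removes letters from the right, since the last letter is the one applied
  directly to \<open>A\<close>. It moves from the string into the formula by one step of
  \<open>h\<close>.\<close>

lemma sharp_Val_lookahead:
  assumes h: "h \<in> Val Sig (sharp Sig M Ax \<Theta>)"
    and closed: "\<And>w u. w \<in> \<Theta> \<Longrightarrow> prefix u w \<Longrightarrow> u \<in> \<Theta>"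
    and "w \<in> \<Theta>" "w \<in> lists (Sig 1)" "A \<in> forms Sig"
  shows "h A w = h (app_str w A) []"
  using assms(3-)
proof (induction w arbitrary: A rule: rev_induct)
  case (snoc u w)
  have u: "u \<in> Sig 1" and w: "w \<in> lists (Sig 1)" "w \<in> \<Theta>"
    using snoc.prems closed by auto
  have "h (App u [A]) \<in> interp (sharp Sig M Ax \<Theta>) u [h A]"
    using h u snoc.prems(3) unfolding Val_def by (fastforce dest!: spec[of _ "[A]"])
  then obtain v A' where
    "look \<Theta> v A' = h A" and "h (App u [A]) = look \<Theta> v (App u [A'])"
    by (rule sharp_interpD) auto
  \<comment> \<open>Both sides equal \<open>v (app_str (w @ [u]) A')\<close>, for the
    \<open>v\<close> and \<open>A'\<close> witnessing this step.\<close>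
  then have "h A (w @ [u]) = h (App u [A]) w"
    using w(2) snoc.prems(1) by (metis look_apply app_str_append app_str.simps)
  also have "\<dots> = h (app_str w (App u [A])) []"
    by (intro snoc.IH w unary_in_forms u snoc.prems(3))
  finally show ?case by (simp add: app_str_append)
qed simp

lemma obtain_substitution:
  assumes "length ps = length As" "set As \<subseteq> forms Sig" "distinct ps"
  obtains \<tau> where "\<tau> \<in> substitutions Sig" "map \<tau> ps = As"
proof
  \<comment> \<open>Variables outside \<open>ps\<close> are fixed, which keeps every value a
    formula.\<close>
  let ?t = "\<lambda>p. case map_of (zip ps As) p of None \<Rightarrow> Var p | Some A \<Rightarrow> A"
  show "?t \<in> substitutions Sig"
    using assms(2)
    by (auto simp: substitutions_def split: option.split
        dest!: map_of_SomeD set_zip_rightD intro: formulas.Var)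
  show "map ?t ps = As"
    using assms by (auto intro!: nth_equalityI simp: map_of_zip_nth)
qed

text \<open>A leaf is a string applied either to some \<open>p\<close> or to the base compound. That
  string is a prefix of itself, hence in \<open>\<Theta>\<close>, so one of the two agreement
  hypotheses applies.\<close>

lemma decomposes_leaf_agree:
  assumes d: "decomposes Sig Sigd B d" and \<Theta>: "lookahead d \<subseteq> \<Theta>"
    and q: "q \<in> fst ` set (qvars d @ rvars d)"
    and p: "\<And>w p. w \<in> \<Theta> \<Longrightarrow> w \<in> lists (unaries Sig Sigd) \<Longrightarrow> p \<in> set (pvars d) \<Longrightarrow>
      v (app_str w (\<tau> p)) = v' (app_str w (\<tau>' p))"
    and c: "\<And>w. w \<in> \<Theta> \<Longrightarrow> w \<in> lists (unaries Sig Sigd) \<Longrightarrow>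
      v (app_str w (App (base d) (map \<tau> (pvars d)))) =
      v' (app_str w (App (base d) (map \<tau>' (pvars d))))"
  shows "v (subst \<tau> (subst_of d q)) = v' (subst \<tau>' (subst_of d q))"
proof -
  from q obtain w where "(q, w) \<in> set (qvars d) \<or> (q, w) \<in> set (rvars d)" by fastforce
  then show ?thesis
  proof
    assume qw: "(q, w) \<in> set (qvars d)"
    then have "w \<in> \<Theta>" using \<Theta> by (auto simp: lookahead_def)
    moreover have "w \<in> lists (unaries Sig Sigd)"
      and "\<exists>p\<in>set (pvars d). subst_of d q = app_str w (Var p)"
      using d qw unfolding decomposes_def by blast+
    ultimately show ?thesis using p by (force simp: subst_app_str)
  next
    assume qw: "(q, w) \<in> set (rvars d)"
    then have "w \<in> \<Theta>" using \<Theta> by (auto simp: lookahead_def)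
    moreover have "w \<in> lists (unaries Sig Sigd)"
      and "subst_of d q = app_str w (App (base d) (map Var (pvars d)))"
      using d qw unfolding decomposes_def by blast+
    ultimately show ?thesis using c by (simp add: subst_app_str comp_def)
  qed
qed

text \<open>In \<open>M\<close> the two instances may take different values even when the leaves
  agree. Determinism is only available in \<open>M0\<close>, where the contracted values coincide,
  and this suffices for designation.\<close>

lemma decomposes_desig_transfer:
  assumes M0: "is_pnmatrix Sig M0" "deterministic Sigd M0" "rexpansion Sig M0 M"
    and sub: "\<forall>k. Sigd k \<subseteq> Sig k"
    and d: "decomposes Sig Sigd B d"
    and v: "v \<in> Val Sig M" "v' \<in> Val Sig M"
    and \<tau>: "\<tau> \<in> substitutions Sig" "\<tau>' \<in> substitutions Sig"
    and leaves: "\<And>q. q \<in> fst ` set (qvars d @ rvars d) \<Longrightarrow>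
      v (subst \<tau> (subst_of d q)) = v' (subst \<tau>' (subst_of d q))"
  shows "v (subst \<tau> B) \<in> desig M \<longleftrightarrow> v' (subst \<tau>' B) \<in> desig M"
proof -
  obtain E where E: "expansion_fun (vals M0) E" and ref: "refinement Sig (expansion E M0) M"
    using M0(3) by (auto simp: rexpansion_def)
  let ?k = "contract (vals M0) E"
  let ?s = "\<lambda>\<tau> q. subst \<tau> (subst_of d q)"
  have \<sigma>: "subst_of d \<in> substitutions Sig"
    and A: "struct_fm d \<in> formulas Sigd (fst ` set (qvars d @ rvars d))"
    and B: "B = subst (subst_of d) (struct_fm d)" "B \<in> formulas Sig (set (pvars d))"
    using d by (auto simp: decomposes_def)
  have s: "?s \<tau> \<in> substitutions Sig" if "\<tau> \<in> substitutions Sig" for \<tau>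
    using \<sigma> subst_in_forms[OF _ that] unfolding substitutions_def by blast
  have fm: "subst \<tau> B \<in> forms Sig" "subst \<tau>' B \<in> forms Sig"
    using subst_in_forms[OF B(2)] \<tau> by blast+
  have "(\<lambda>A\<in>forms Sig. ?k (v A)) (subst (?s \<tau>) (struct_fm d)) =
        (\<lambda>A\<in>forms Sig. ?k (v' A)) (subst (?s \<tau>') (struct_fm d))"
  proof (rule deterministic_agree[OF M0(2) sub contract_Val[OF M0(1) E ref v(1)]
        contract_Val[OF M0(1) E ref v(2)] s[OF \<tau>(1)] s[OF \<tau>(2)] _ A])
    fix q assume "q \<in> fst ` set (qvars d @ rvars d)"
    then show "(\<lambda>A\<in>forms Sig. ?k (v A)) (?s \<tau> q) = (\<lambda>A\<in>forms Sig. ?k (v' A)) (?s \<tau>' q)"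
      using leaves s[OF \<tau>(1)] s[OF \<tau>(2)] by (simp add: substitutions_def)
  qed
  then have "?k (v (subst \<tau> B)) = ?k (v' (subst \<tau>' B))"
    using fm by (simp add: B(1) subst_subst)
  then show ?thesis
    using contract_desig[OF M0(1) E ref] Val_in_forms[OF v(1) fm(1)] Val_in_forms[OF v(2) fm(2)]
    by metis
qed

lemma sharp_Val_eval:
  assumes "is_pnmatrix Sig M" "[] \<in> \<Theta>" and h: "h \<in> Val Sig (sharp Sig M Ax \<Theta>)"
  shows "(\<lambda>A\<in>forms Sig. h A []) \<in> Val Sig M"
proof -
  have "h A [] \<in> vals M" if "A \<in> forms Sig" for A
    using Val_in_forms[OF h that] sharp_vals_Nil[OF assms(2)] by (simp add: sharp_def)
  then have "(\<lambda>A\<in>forms Sig. contract (vals M) (\<lambda>x. {f. f [] = x}) (h A)) =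
      (\<lambda>A\<in>forms Sig. h A [])"
    by (intro restrict_ext contract_eval)
  then show ?thesis
    using contract_Val[OF assms(1) expansion_fun_eval sharp_refinement[OF assms(1,2)] h] by simp
qed

text \<open>No single valuation in \<open>ValAx\<close> need explain all of \<open>h\<close>.
  Simplicity makes each axiom instance depend on one step of \<open>h\<close> at the base
  connective, and a witness for that step alone is enough.\<close>

lemma sharp_Val_ValAx:
  assumes M: "is_pnmatrix Sig M" and sub: "\<forall>k. Sigd k \<subseteq> Sig k"
    and M0: "is_pnmatrix Sig M0" "deterministic Sigd M0" "rexpansion Sig M0 M"
    and dec: "\<forall>B \<in> Ax. decomposes Sig Sigd B (dec B)"
    and h: "h \<in> Val Sig (sharp Sig M Ax (lookahead_set dec Ax))"
  shows "(\<lambda>A\<in>forms Sig. h A []) \<in> ValAx Sig M Ax"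
proof -
  let ?\<Theta> = "lookahead_set dec Ax" and ?v = "\<lambda>A\<in>forms Sig. h A []"
  have v: "?v \<in> Val Sig M" by (rule sharp_Val_eval[OF M Nil_in_lookahead_set h])
  have ahead: "?v (app_str w A) = h A w"
    if "w \<in> ?\<Theta>" "w \<in> lists (unaries Sig Sigd)" "A \<in> forms Sig" for w A
  proof -
    have w: "w \<in> lists (Sig 1)" using that(2) by (auto simp: unaries_def)
    then have "app_str w A \<in> forms Sig"
      using that(3) by (induction w) (auto intro: unary_in_forms)
    then show ?thesis
      using sharp_Val_lookahead[OF h lookahead_set_prefix that(1) w that(3)] by simp
  qed
  have "?v (subst \<tau> B) \<in> desig M" if B: "B \<in> Ax" and \<tau>: "\<tau> \<in> substitutions Sig" for \<tau> B
  proof -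
    let ?d = "dec B"
    let ?ps = "pvars ?d"
    have d: "decomposes Sig Sigd B ?d" using dec B by blast
    then have c: "base ?d \<in> Sig (length ?ps)" and ps: "distinct ?ps"
      by (auto simp: decomposes_def)
    have fm: "set (map \<tau> ?ps) \<subseteq> forms Sig" using \<tau> by (auto simp: substitutions_def)
    have "h (App (base ?d) (map \<tau> ?ps)) \<in>
        interp (sharp Sig M Ax ?\<Theta>) (base ?d) (map h (map \<tau> ?ps))"
      using h c fm unfolding Val_def by (simp only: mem_Collect_eq length_map)
    then obtain v' As where v': "v' \<in> ValAx Sig M Ax" and As: "set As \<subseteq> forms Sig"
      and args: "map (look ?\<Theta> v') As = map h (map \<tau> ?ps)"
      and res: "h (App (base ?d) (map \<tau> ?ps)) = look ?\<Theta> v' (App (base ?d) As)"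
      by (rule sharp_interpD)
    \<comment> \<open>The witnessing formulas \<open>As\<close> need not be the arguments
      \<open>map \<tau> ?ps\<close>. They are therefore turned into a second substitution, giving
      another instance of the same axiom.\<close>
    from args have "length ?ps = length As" by (metis length_map)
    from obtain_substitution[OF this As ps] obtain \<tau>'
      where \<tau>': "\<tau>' \<in> substitutions Sig" "map \<tau>' ?ps = As" .
    have args': "look ?\<Theta> v' (\<tau>' p) = h (\<tau> p)" if "p \<in> set ?ps" for p
      using args that by (auto simp flip: \<tau>'(2))
    have leaves: "?v (subst \<tau> (subst_of ?d q)) = v' (subst \<tau>' (subst_of ?d q))"
      if q: "q \<in> fst ` set (qvars ?d @ rvars ?d)" for q
    proof (rule decomposes_leaf_agree[OF d _ q])
      show "lookahead ?d \<subseteq> ?\<Theta>" using B by (auto simp: lookahead_set_def)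
    next
      fix w p
      assume w: "w \<in> ?\<Theta>" "w \<in> lists (unaries Sig Sigd)" and p: "p \<in> set ?ps"
      show "?v (app_str w (\<tau> p)) = v' (app_str w (\<tau>' p))"
        using ahead[OF w] fm p look_eqD[OF args'[OF p] w(1)] by (metis image_eqI set_map subsetD)
    next
      fix w
      assume w: "w \<in> ?\<Theta>" "w \<in> lists (unaries Sig Sigd)"
      have "App (base ?d) (map \<tau> ?ps) \<in> forms Sig"
        using c fm by (intro formulas.App) auto
      then show "?v (app_str w (App (base ?d) (map \<tau> ?ps))) =
          v' (app_str w (App (base ?d) (map \<tau>' ?ps)))"
        using ahead[OF w] look_eqD[OF res[symmetric] w(1)] by (simp only: \<tau>'(2))
    qed
    \<comment> \<open>\<open>v'\<close> satisfies every instance of every axiom, including this one;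
      designation is then carried back to the instance under \<tau>.\<close>
    have "v' (subst \<tau>' B) \<in> desig M"
      using v' B \<tau>'(1) by (auto simp: ValAx_def inst_def)
    then show ?thesis
      using decomposes_desig_transfer[OF M0 sub d v ValAxD[OF v'] \<tau> \<tau>'(1) leaves] by blast
  qed
  then show ?thesis using v unfolding ValAx_def inst_def by blast
qed

section \<open>Rexpansion and equality of the consequence relations\<close>

theorem theorem3p7:
  fixes Sig Sigd :: "'c signature"
    and M :: "('c, 'v) pnmatrix"
    and M0 :: "('c, 'a) pnmatrix"
    and Ax :: "'c fm set"
    and dec :: "'c fm \<Rightarrow> 'c decomp"
  assumes "is_pnmatrix Sig M"
    and "Ax \<subseteq> forms Sig"
    and "\<forall>k. Sigd k \<subseteq> Sig k"
    and "is_pnmatrix Sig M0"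
    and "deterministic Sigd M0"
    and "rexpansion Sig M0 M"
    and "\<forall>B \<in> Ax. simple Sig Sigd B"
    and "\<forall>B \<in> Ax. decomposes Sig Sigd B (dec B)"
  shows "rexpansion Sig M (sharp Sig M Ax (lookahead_set dec Ax)) \<and>
         conseq_ax Sig M Ax = conseq Sig (sharp Sig M Ax (lookahead_set dec Ax))"
proof
  let ?\<Theta> = "lookahead_set dec Ax"
  let ?S = "sharp Sig M Ax ?\<Theta>"
  have Nil: "[] \<in> ?\<Theta>" by (rule Nil_in_lookahead_set)
  show "rexpansion Sig M ?S"
    unfolding rexpansion_def
    \<comment> \<open>The first rule makes the unknown expansion function evaluation at some string,
      and the second fixes that string as \<open>[]\<close>.\<close>
    by (intro exI conjI) (rule expansion_fun_eval, rule sharp_refinement[OF assms(1) Nil])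
  have desig_iff: "h A \<in> desig ?S \<longleftrightarrow> h A [] \<in> desig M"
    if "h \<in> Val Sig ?S" "A \<in> forms Sig" for h A
    using Val_in_forms[OF that] by (simp add: sharp_def)
  have "(\<forall>v\<in>Val Sig M. v ` (\<Gamma> \<union> inst Sig Ax) \<subseteq> desig M \<longrightarrow> v A \<in> desig M) \<longleftrightarrow>
        (\<forall>h\<in>Val Sig ?S. h ` \<Gamma> \<subseteq> desig ?S \<longrightarrow> h A \<in> desig ?S)" (is "?L \<longleftrightarrow> ?R")
    if \<Gamma>: "\<Gamma> \<subseteq> forms Sig" and A: "A \<in> forms Sig" for \<Gamma> A
  proof
    assume L: ?L
    show ?R
    proof (intro ballI impI)
      fix h assume h: "h \<in> Val Sig ?S" and des: "h ` \<Gamma> \<subseteq> desig ?S"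
      \<comment> \<open>A countermodel in the look-ahead matrix is evaluated at \<open>[]\<close> to
        give one in \<open>M\<close> that satisfies the axioms.\<close>
      let ?v = "\<lambda>A\<in>forms Sig. h A []"
      have v: "?v \<in> ValAx Sig M Ax"
        by (rule sharp_Val_ValAx[OF assms(1,3-6,8) h])
      have "?v ` \<Gamma> \<subseteq> desig M"
        using des \<Gamma> desig_iff[OF h] by auto
      then have "?v A \<in> desig M"
        using L v unfolding ValAx_def by (simp only: mem_Collect_eq image_Un Un_subset_iff)
      then show "h A \<in> desig ?S" using A desig_iff[OF h] by simp
    qed
  next
    assume R: ?R
    show ?L
    proof (intro ballI impI)
      fix v assume "v \<in> Val Sig M" and des: "v ` (\<Gamma> \<union> inst Sig Ax) \<subseteq> desig M"
      then have v: "v \<in> ValAx Sig M Ax" by (auto simp: ValAx_def)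
      \<comment> \<open>Conversely, a countermodel in \<open>M\<close> satisfying the axioms is
        lifted to its look-ahead functions.\<close>
      let ?h = "\<lambda>A\<in>forms Sig. look ?\<Theta> v A"
      have h: "?h \<in> Val Sig ?S" by (rule look_Val[OF v])
      have eq: "?h B \<in> desig ?S \<longleftrightarrow> v B \<in> desig M" if "B \<in> forms Sig" for B
        using desig_iff[OF h that] that Nil by (simp add: look_apply)
      then have "?h ` \<Gamma> \<subseteq> desig ?S" using \<Gamma> des by blast
      then have "?h A \<in> desig ?S" using R h by blast
      then show "v A \<in> desig M" using eq[OF A] by blast
    qed
  qed
  then show "conseq_ax Sig M Ax = conseq Sig ?S"
    \<comment> \<open>The well-formedness conditions on the two sides agree because all axiom
      instances are formulas.\<close>
    using inst_subset_forms[OF assms(2)]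
    unfolding conseq_ax_def conseq_def fun_eq_iff by (metis Un_subset_iff)
qed

end
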